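(* Let $X=(X_1,\dots,X_n)$ be a random vector in $\mathbb{R}^n$ with strictly positive, $n+1$ times continuously differentiable density $f_X$. Then $X_1,\dots,X_n$ are (mutually) independent if and only if $\kappa_{e_i+e_j}^x=0$ for all $x\in\mathbb{R}^n$ and all $(i,j)\in\{1,\dots,n\}^2$ with $i\neq j$.
   Context: $e_i$ is the $i$-th standard unit vector of $\mathbb{R}^n$. For $i\ne j$, the differential cumulant at $x$ is $\kappa_{e_i+e_j}^x=\frac{\partial^2}{\partial x_i\partial x_j}\log f_X(x)$. *)

theory Defs
  imports "HOL-Probability.Probability"
begin

text \<open>
  Being \<open>k\<close> times continuously differentiable on the whole space, by recursion on \<open>k\<close>:
  the derivative is required to exist in the Frechet sense, and all directional derivatives
  have to be \<open>k - 1\<close> times continuously differentiable. In finite dimension this is the usual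
  notion (all partial derivatives up to order \<open>k\<close> exist and are continuous).
\<close>

primrec times_cont_diff ::
    "nat \<Rightarrow> ('a::real_normed_vector \<Rightarrow> 'b::real_normed_vector) \<Rightarrow> bool" where
  "times_cont_diff 0 f \<longleftrightarrow> continuous_on UNIV f"
| "times_cont_diff (Suc k) f \<longleftrightarrow>
     (\<forall>x. f differentiable (at x)) \<and>
     (\<forall>v. times_cont_diff k (\<lambda>x. frechet_derivative f (at x) v))"

definition partial_deriv :: "'n \<Rightarrow> (real ^ 'n \<Rightarrow> real) \<Rightarrow> real ^ 'n \<Rightarrow> real" where
  "partial_deriv i g x = deriv (\<lambda>t. g (x + t *\<^sub>R axis i 1)) 0"

text \<open>
  The differential cumulant of index \<open>e\<^sub>i + e\<^sub>j\<close> at \<open>x\<close> of a random vector with density \<open>f\<close>.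
  It is meant for \<open>i \<noteq> j\<close>, a positive density \<open>f\<close>, and \<open>f\<close> at least twice continuously
  differentiable; elsewhere its value carries no meaning.
\<close>

definition diff_cumulant :: "(real ^ 'n \<Rightarrow> real) \<Rightarrow> 'n \<Rightarrow> 'n \<Rightarrow> real ^ 'n \<Rightarrow> real" where
  "diff_cumulant f i j x = partial_deriv i (partial_deriv j (\<lambda>y. ln (f y))) x"

end

theory Submission
  imports Defs
begin

text \<open>
  If the \<open>X\<^sub>i\<close> are independent, the probabilities of boxes are products. Averaging over
  shrinking cubes, continuity of \<open>f\<close> turns this into the pointwise identity
  \<open>f x * f (x + s e\<^sub>i + t e\<^sub>j) = f (x + s e\<^sub>i) * f (x + t e\<^sub>j)\<close>, without any regularity
  of marginal densities; taking logarithms, the mixed second derivatives vanish. Conversely, if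
  they vanish, the \<open>j\<close>-th partial derivative of \<open>ln f\<close> depends on the \<open>j\<close>-th coordinate only,
  so \<open>ln f\<close> is a sum of functions of single coordinates, and \<open>f\<close> is a product.
\<close>

section \<open>Separation of variables\<close>

text \<open>Chain rule for \<open>g\<close> composed with an affine line. It reduces questions about
  \<open>g\<close> to one real variable, where a zero derivative forces constancy.\<close>

lemma has_real_derivative_along_line:
  fixes g :: "'v::real_normed_vector \<Rightarrow> real"
  assumes "g differentiable (at (x + t *\<^sub>R v))"
  shows "((\<lambda>t. g (x + t *\<^sub>R v)) has_real_derivative
           frechet_derivative g (at (x + t *\<^sub>R v)) v) (at t)"
proof -
  let ?g' = "frechet_derivative g (at (x + t *\<^sub>R v))"
  have g': "(g has_derivative ?g') (at (x + t *\<^sub>R v))"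
    using assms by (simp add: frechet_derivative_works)
  have "((\<lambda>t. x + t *\<^sub>R v) has_derivative (\<lambda>h. h *\<^sub>R v)) (at t)"
    by (auto intro!: derivative_eq_intros)
  from has_derivative_compose[OF this g']
  have "((\<lambda>t. g (x + t *\<^sub>R v)) has_derivative (\<lambda>h. ?g' (h *\<^sub>R v))) (at t)" .
  moreover have "(\<lambda>h. ?g' (h *\<^sub>R v)) = (*) (?g' v)"
    using linear_frechet_derivative[OF assms] by (auto simp: linear_cmul mult.commute)
  ultimately show ?thesis
    by (simp add: has_field_derivative_def)
qed

lemma partial_deriv_eq_frechet_derivative:
  assumes "g differentiable (at x)"
  shows "partial_deriv i g x = frechet_derivative g (at x) (axis i 1)"
  unfolding partial_deriv_def
  by (rule DERIV_imp_deriv) (use has_real_derivative_along_line[of g x 0 "axis i 1"] assms in simp)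

lemma frechet_derivative_eq_sum_partial_deriv:
  fixes g :: "real ^ 'n \<Rightarrow> real"
  assumes "g differentiable (at x)"
  shows "frechet_derivative g (at x) v = (\<Sum>i\<in>UNIV. v $ i * partial_deriv i g x)"
proof -
  have lin: "linear (frechet_derivative g (at x))"
    using assms by (rule linear_frechet_derivative)
  have "frechet_derivative g (at x) v
      = frechet_derivative g (at x) (\<Sum>i\<in>UNIV. v $ i *\<^sub>R axis i 1)"
    by (simp add: basis_expansion flip: scalar_mult_eq_scaleR)
  also have "\<dots> = (\<Sum>i\<in>UNIV. v $ i * frechet_derivative g (at x) (axis i 1))"
    by (simp add: linear_sum[OF lin] linear_cmul[OF lin])
  finally show ?thesis
    by (simp add: partial_deriv_eq_frechet_derivative[OF assms])
qed

text \<open>The direction \<open>y - x\<close> has no \<open>j\<close>-th component, so in the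
  expansion of the derivative of \<open>g\<close> along the segment from \<open>x\<close> to
  \<open>y\<close> each term contains a zero factor.\<close>

lemma eq_if_partial_derivs_zero:
  fixes g :: "real ^ 'n \<Rightarrow> real"
  assumes diff: "\<And>x. g differentiable (at x)"
    and zero: "\<And>x i. i \<noteq> j \<Longrightarrow> partial_deriv i g x = 0"
    and "x $ j = y $ j"
  shows "g x = g y"
proof -
  have "(y - x) $ i * partial_deriv i g z = 0" for i and z :: "real ^ 'n"
    using assms(3) zero by (cases "i = j") auto
  then have "frechet_derivative g (at z) (y - x) = 0" for z
    by (simp only: frechet_derivative_eq_sum_partial_deriv[OF diff] sum.neutral_const)
  then have "((\<lambda>t. g (x + t *\<^sub>R (y - x))) has_real_derivative 0) (at t)" for t
    using has_real_derivative_along_line[OF diff, where x = x and v = "y - x"] by simp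
  then have "g (x + 0 *\<^sub>R (y - x)) = g (x + 1 *\<^sub>R (y - x))"
    by (rule DERIV_isconst_all[rule_format, rotated])
  then show ?thesis by simp
qed

text \<open>
  Each \<open>partial_deriv j g\<close> depends on the \<open>j\<close>-th coordinate only, so
  \<open>t \<mapsto> g (t x) - (\<Sum>i. g (t x\<^sub>i e\<^sub>i))\<close> has derivative zero.
\<close>
lemma additively_separable:
  fixes g :: "real ^ 'n \<Rightarrow> real"
  assumes diff: "\<And>x. g differentiable (at x)"
    and diff2: "\<And>x j. partial_deriv j g differentiable (at x)"
    and mixed: "\<And>x i j. i \<noteq> j \<Longrightarrow> partial_deriv i (partial_deriv j g) x = 0"
  shows "g x = g 0 + (\<Sum>i\<in>UNIV. g (axis i (x $ i)) - g 0)"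
proof -
  \<comment> \<open>The summand \<open>0 +\<close> keeps all terms in the shape of
    \<open>has_real_derivative_along_line\<close> with base point \<open>0\<close>.\<close>
  define \<psi> where "\<psi> t = g (0 + t *\<^sub>R x) - (\<Sum>i\<in>UNIV. g (0 + t *\<^sub>R axis i (x $ i)))" for t
  have axis: "frechet_derivative g (at (0 + t *\<^sub>R axis i (x $ i))) (axis i (x $ i))
      = x $ i * partial_deriv i g (0 + t *\<^sub>R x)" for t i
  proof -
    have "frechet_derivative g (at (0 + t *\<^sub>R axis i (x $ i))) (axis i (x $ i))
        = (\<Sum>k\<in>UNIV. if k = i then x $ i * partial_deriv i g (0 + t *\<^sub>R axis i (x $ i)) else 0)"
      unfolding frechet_derivative_eq_sum_partial_deriv[OF diff]
      by (intro sum.cong) (auto simp: axis_def)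
    also have "\<dots> = x $ i * partial_deriv i g (0 + t *\<^sub>R axis i (x $ i))"
      by simp
    \<comment> \<open>Both points have \<open>i\<close>-th coordinate \<open>t * x $ i\<close>, and
      by \<open>mixed\<close> the function \<open>partial_deriv i g\<close> is constant in all other
      directions.\<close>
    also have "partial_deriv i g (0 + t *\<^sub>R axis i (x $ i)) = partial_deriv i g (0 + t *\<^sub>R x)"
      by (rule eq_if_partial_derivs_zero[where j = i]) (auto simp: diff2 mixed)
    finally show ?thesis .
  qed
  have "(\<psi> has_real_derivative
      frechet_derivative g (at (0 + t *\<^sub>R x)) x
      - (\<Sum>i\<in>UNIV. frechet_derivative g (at (0 + t *\<^sub>R axis i (x $ i))) (axis i (x $ i)))) (at t)" for t
    unfolding \<psi>_def
    by (intro DERIV_diff DERIV_sum has_real_derivative_along_line diff)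
  then have "(\<psi> has_real_derivative 0) (at t)" for t
    unfolding axis unfolding frechet_derivative_eq_sum_partial_deriv[OF diff] by simp
  then have "\<psi> 1 = \<psi> 0"
    by (rule DERIV_isconst_all[rule_format])
  then show ?thesis
    by (simp add: \<psi>_def sum_subtractf)
qed

section \<open>The logarithm of a positive smooth function\<close>

lemma ln_partial_derivs_differentiable:
  fixes f :: "real ^ 'n \<Rightarrow> real"
  assumes pos: "\<And>x. 0 < f x"
    and smooth: "times_cont_diff (Suc (Suc k)) f"
  shows "(\<lambda>x. ln (f x)) differentiable (at x)"
    and "partial_deriv j (\<lambda>x. ln (f x)) differentiable (at x)"
proof -
  have f: "f differentiable (at x)"
    and f': "(\<lambda>x. frechet_derivative f (at x) v) differentiable (at x)" for x v
    using smooth by auto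
  have ln: "((\<lambda>x. ln (f x)) has_derivative (\<lambda>h. frechet_derivative f (at x) h / f x)) (at x)" for x
    using f[of x] pos[of x] unfolding frechet_derivative_works
    by (auto intro!: derivative_eq_intros simp: divide_inverse)
  then show diff: "(\<lambda>x. ln (f x)) differentiable (at x)" for x
    by (auto simp: differentiable_def)
  \<comment> \<open>As a quotient, the partial derivative is seen to be differentiable: the
    numerator is a directional derivative of \<open>f\<close>, covered by the second order of
    smoothness, and the denominator is positive.\<close>
  have "partial_deriv j (\<lambda>x. ln (f x)) = (\<lambda>x. frechet_derivative f (at x) (axis j 1) / f x)"
    by (rule ext) (simp add: partial_deriv_eq_frechet_derivative[OF diff]
      frechet_derivative_at[OF ln, symmetric])
  then show "partial_deriv j (\<lambda>x. ln (f x)) differentiable (at x)"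
    using pos[of x] f f' by (auto intro!: differentiable_divide)
qed

text \<open>This is the additive separation of \<open>ln f\<close>, exponentiated: the differences
  \<open>ln (f (axis i (x $ i))) - ln (f 0)\<close> become the quotients in the product.\<close>

lemma product_form_if_diff_cumulants_zero:
  fixes f :: "real ^ 'n \<Rightarrow> real"
  assumes pos: "\<And>x. 0 < f x"
    and smooth: "times_cont_diff (Suc (Suc k)) f"
    and zero: "\<And>x i j. i \<noteq> j \<Longrightarrow> diff_cumulant f i j x = 0"
  shows "f x = f 0 * (\<Prod>i\<in>UNIV. f (axis i (x $ i)) / f 0)"
proof -
  note [simp] = less_imp_neq[OF pos, symmetric]
  have "ln (f x) = ln (f 0) + (\<Sum>i\<in>UNIV. ln (f (axis i (x $ i))) - ln (f 0))"
    using ln_partial_derivs_differentiable[OF pos smooth] zero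
    by (intro additively_separable) (auto simp: diff_cumulant_def)
  also have "\<dots> = ln (f 0) + (\<Sum>i\<in>UNIV. ln (f (axis i (x $ i)) / f 0))"
    using pos by (simp add: ln_div)
  also have "\<dots> = ln (f 0) + ln (\<Prod>i\<in>UNIV. f (axis i (x $ i)) / f 0)"
    using pos by (subst ln_prod) (auto intro: divide_pos_pos)
  also have "\<dots> = ln (f 0 * (\<Prod>i\<in>UNIV. f (axis i (x $ i)) / f 0))"
    using pos by (subst ln_mult) (auto intro!: prod_pos divide_pos_pos)
  finally show ?thesis
    using pos by (subst (asm) ln_inj_iff) (auto intro!: mult_pos_pos prod_pos divide_pos_pos)
qed

section \<open>Densities of product form\<close>

lemma prod_Basis_cart:
  fixes g :: "real ^ 'n \<Rightarrow> 'b::comm_monoid_mult"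
  shows "(\<Prod>b\<in>Basis. g b) = (\<Prod>i\<in>UNIV. g (axis i 1))"
proof -
  have Basis: "(Basis :: (real ^ 'n) set) = (\<lambda>i. axis i 1) ` UNIV"
    by (auto simp: Basis_vec_def)
  show ?thesis
    by (subst Basis, subst prod.reindex) (simp_all add: inj_on_def axis_eq_axis)
qed

lemma nn_integral_lborel_prod_cart:
  fixes h :: "'n::finite \<Rightarrow> real \<Rightarrow> ennreal"
  assumes "\<And>i. h i \<in> borel_measurable borel"
  shows "(\<integral>\<^sup>+x. (\<Prod>i\<in>UNIV. h i (x $ i)) \<partial>(lborel :: (real ^ 'n) measure))
       = (\<Prod>i\<in>UNIV. \<integral>\<^sup>+t. h i t \<partial>lborel)"
proof -
  \<comment> \<open>Inverse of the map from \<open>i\<close> to \<open>axis i 1\<close>. It turns a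
    family indexed by coordinates into one indexed by basis vectors, as
    \<open>nn_integral_lborel_prod\<close> expects; off the basis its value is unspecified.\<close>
  define index :: "real ^ 'n \<Rightarrow> 'n" where "index b = (THE i. b = axis i 1)" for b
  have index: "index (axis i 1) = i" for i
    by (auto simp: index_def axis_eq_axis)
  show ?thesis
    using nn_integral_lborel_prod[where f = "\<lambda>b :: real ^ 'n. h (index b)"] assms
    by (simp add: prod_Basis_cart index inner_axis)
qed

lemma measurable_vec_nth [measurable]: "(\<lambda>x :: real ^ 'n. x $ i) \<in> borel_measurable borel"
  by (intro borel_measurable_continuous_onI continuous_intros)

text \<open>Integrating the product over a box gives \<open>c\<close> times a product of
  one-dimensional integrals. The factors \<open>h i\<close> are not normalised individually; only
  \<open>c\<close> times the product of their total masses is known to be 1. Boxes that constrain a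
  single coordinate then relate each integral to a marginal probability.\<close>

lemma indep_vars_if_product_form:
  fixes X :: "'a \<Rightarrow> real ^ 'n" and h :: "'n \<Rightarrow> real \<Rightarrow> real"
  assumes "prob_space M"
    and X: "distributed M lborel X (\<lambda>x. ennreal (f x))"
    and f: "\<And>x. f x = c * (\<Prod>i\<in>UNIV. h i (x $ i))"
    and c: "0 \<le> c" and h: "\<And>i t. 0 \<le> h i t"
    and h_meas [measurable]: "\<And>i. h i \<in> borel_measurable borel"
  shows "prob_space.indep_vars M (\<lambda>i. borel) (\<lambda>i \<omega>. X \<omega> $ i) UNIV"
proof -
  interpret prob_space M by fact
  have [measurable]: "X \<in> borel_measurable M"
    using distributed_measurable[OF X] by simp
  define a where "a A i = (\<integral>\<^sup>+t. ennreal (h i t) * indicator (A i) t \<partial>lborel)"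
    for A :: "'n \<Rightarrow> real set" and i
  have box: "emeasure M (\<Inter>i\<in>UNIV. (\<lambda>\<omega>. X \<omega> $ i) -` A i \<inter> space M)
      = ennreal c * (\<Prod>i\<in>UNIV. a A i)"
    if [measurable]: "\<And>i. A i \<in> sets borel" for A
  proof -
    let ?B = "{x :: real ^ 'n. \<forall>i. x $ i \<in> A i}"
    have [measurable]: "?B \<in> sets borel" by measurable
    have "emeasure M (\<Inter>i\<in>UNIV. (\<lambda>\<omega>. X \<omega> $ i) -` A i \<inter> space M)
        = emeasure M (X -` ?B \<inter> space M)"
      by (rule arg_cong[where f = "emeasure M"]) auto
    also have "\<dots> = (\<integral>\<^sup>+x. ennreal (f x) * indicator ?B x \<partial>lborel)"
      by (rule distributed_emeasure[OF X]) simp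
    also have "\<dots> = (\<integral>\<^sup>+x. ennreal c * (\<Prod>i\<in>UNIV. ennreal (h i (x $ i)) * indicator (A i) (x $ i)) \<partial>lborel)"
    proof (rule nn_integral_cong)
      fix x :: "real ^ 'n"
      have "(indicator ?B x :: ennreal) = (\<Prod>i\<in>UNIV. indicator (A i) (x $ i))"
        by (auto simp: indicator_def intro!: prod.neutral)
      then show "ennreal (f x) * indicator ?B x
          = ennreal c * (\<Prod>i\<in>UNIV. ennreal (h i (x $ i)) * indicator (A i) (x $ i))"
        using c h by (simp add: f ennreal_mult prod_nonneg prod_ennreal prod.distrib mult.assoc)
    qed
    also have "\<dots> = ennreal c * (\<Prod>i\<in>UNIV. a A i)"
      unfolding a_def
      by (simp add: nn_integral_cmult
        nn_integral_lborel_prod_cart[where h = "\<lambda>i t. ennreal (h i t) * indicator (A i) t"])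
    finally show ?thesis .
  qed
  have total: "ennreal c * (\<Prod>i\<in>UNIV. a (\<lambda>_. UNIV) i) = 1"
    using box[of "\<lambda>_. UNIV"] emeasure_space_1 by simp
  have marginal: "a A i = a (\<lambda>_. UNIV) i * emeasure M ((\<lambda>\<omega>. X \<omega> $ i) -` A i \<inter> space M)"
    if [measurable]: "\<And>i. A i \<in> sets borel" for A i
  proof -
    \<comment> \<open>The total masses of the coordinates other than \<open>i\<close>, which the box
      \<open>?A\<close> leaves unconstrained.\<close>
    define d where "d = (\<Prod>k\<in>UNIV - {i}. a (\<lambda>_. UNIV) k)"
    let ?A = "\<lambda>k. if k = i then A i else UNIV"
    have "emeasure M ((\<lambda>\<omega>. X \<omega> $ i) -` A i \<inter> space M)
        = emeasure M (\<Inter>k\<in>UNIV. (\<lambda>\<omega>. X \<omega> $ k) -` ?A k \<inter> space M)"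
      by (rule arg_cong[where f = "emeasure M"]) (auto split: if_splits)
    also have "\<dots> = ennreal c * (\<Prod>k\<in>UNIV. a ?A k)"
      by (rule box) simp
    also have "(\<Prod>k\<in>UNIV. a ?A k) = a A i * d"
      unfolding d_def by (subst prod.remove[of _ i]) (auto simp: a_def intro!: prod.cong arg_cong2[where f = times])
    finally have "emeasure M ((\<lambda>\<omega>. X \<omega> $ i) -` A i \<inter> space M) = ennreal c * (a A i * d)" .
    moreover have "ennreal c * (a (\<lambda>_. UNIV) i * d) = 1"
      using total unfolding d_def by (subst (asm) prod.remove[of _ i]) auto
    \<comment> \<open>Multiplying the first identity by \<open>a (\<lambda>_. UNIV) i\<close> and
      inserting the second isolates \<open>a A i\<close> without a division in
      \<open>ennreal\<close>.\<close>
    ultimately show ?thesis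
      by (metis mult.assoc mult.commute mult.right_neutral)
  qed
  have "prob (\<Inter>i\<in>UNIV. (\<lambda>\<omega>. X \<omega> $ i) -` A i \<inter> space M)
      = (\<Prod>i\<in>UNIV. prob ((\<lambda>\<omega>. X \<omega> $ i) -` A i \<inter> space M))"
    if A: "\<And>i. A i \<in> sets borel" for A
  proof -
    have marginals: "(\<Prod>i\<in>UNIV. a A i)
        = (\<Prod>i\<in>UNIV. a (\<lambda>_. UNIV) i * emeasure M ((\<lambda>\<omega>. X \<omega> $ i) -` A i \<inter> space M))"
      by (rule prod.cong[OF refl marginal[OF A]])
    have "emeasure M (\<Inter>i\<in>UNIV. (\<lambda>\<omega>. X \<omega> $ i) -` A i \<inter> space M)
        = ennreal c * (\<Prod>i\<in>UNIV. a (\<lambda>_. UNIV) i)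
          * (\<Prod>i\<in>UNIV. emeasure M ((\<lambda>\<omega>. X \<omega> $ i) -` A i \<inter> space M))"
      unfolding box[OF A] marginals prod.distrib by (simp only: mult.assoc)
    also have "\<dots> = ennreal (\<Prod>i\<in>UNIV. prob ((\<lambda>\<omega>. X \<omega> $ i) -` A i \<inter> space M))"
      by (simp add: total emeasure_eq_measure prod_ennreal)
    finally show ?thesis
      by (simp add: emeasure_eq_measure prod_nonneg)
  qed
  \<comment> \<open>The Borel sets serve as their own intersection-stable generator. It contains the
    whole line, so the product rule over all coordinates at once also covers subfamilies.\<close>
  then show ?thesis
    by (subst indep_vars_finite[where E = "\<lambda>_. sets borel"])
      (auto simp: sets.Int_stable sets.sigma_sets_eq[of borel, simplified] Pi_def)
qed

section \<open>Recovering a continuous density from small boxes\<close>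

lemma emeasure_lborel_cube_cart:
  fixes x :: "real ^ 'n"
  assumes "0 \<le> r"
  shows "emeasure lborel (cbox (\<chi> i. x $ i - r) (\<chi> i. x $ i + r)) = ennreal ((2 * r) ^ CARD('n))"
proof -
  have "(\<Prod>b\<in>Basis. ((\<chi> i. x $ i + r) - (\<chi> i. x $ i - r)) \<bullet> b) = (2 * r) ^ CARD('n)"
    unfolding prod_Basis_cart by (simp add: inner_axis)
  then show ?thesis
    using assms by (subst emeasure_lborel_cbox) (auto simp: Basis_vec_def inner_axis)
qed

text \<open>On a small cube around \<open>x\<close>, continuity keeps \<open>f\<close> within
  \<open>e'\<close> of \<open>f x\<close>. Integrating these bounds and dividing by the volume
  squeezes the average.\<close>

lemma cube_average_tendsto_density:
  fixes X :: "'a \<Rightarrow> real ^ 'n"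
  assumes "prob_space M"
    and X: "distributed M lborel X (\<lambda>x. ennreal (f x))"
    and cont: "continuous_on UNIV f" and nonneg: "\<And>x. 0 \<le> f x"
  shows "((\<lambda>r. measure M (X -` cbox (\<chi> i. x $ i - r) (\<chi> i. x $ i + r) \<inter> space M)
            / (2 * r) ^ CARD('n)) \<longlongrightarrow> f x) (at_right 0)"
proof -
  interpret prob_space M by fact
  define B where "B r = cbox (\<chi> i. x $ i - r) (\<chi> i. x $ i + r)" for r
  define p where "p r = prob (X -` B r \<inter> space M)" for r
  have p: "ennreal (p r) = (\<integral>\<^sup>+y. ennreal (f y) * indicator (B r) y \<partial>lborel)" for r
    unfolding p_def using distributed_emeasure[OF X, of "B r"]
    by (simp add: B_def emeasure_eq_measure)
  have f_meas [measurable]: "f \<in> borel_measurable borel"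
    using cont by (rule borel_measurable_continuous_onI)
  have [measurable]: "B r \<in> sets borel" for r
    by (simp add: B_def)
  have "((\<lambda>r. p r / (2 * r) ^ CARD('n)) \<longlongrightarrow> f x) (at_right 0)"
  proof (rule tendstoI)
    fix e :: real assume "0 < e"
    \<comment> \<open>Integration yields only non-strict bounds, so half of \<open>e\<close> is used
      to end with a strict one.\<close>
    define e' where "e' = e / 2"
    have e': "0 < e'" "e' < e" using \<open>0 < e\<close> by (auto simp: e'_def)
    from cont have "isCont f x" by (simp add: continuous_on_eq_continuous_at)
    then obtain d where "d > 0" and d: "\<And>y. dist y x < d \<Longrightarrow> dist (f y) (f x) < e'"
      using e' unfolding continuous_at_eps_delta by (auto simp: dist_norm)
    \<comment> \<open>The Euclidean norm is at most the sum of the absolute coordinates, so a cube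
      of half-side \<open>r\<close> lies within distance \<open>CARD('n) * r\<close> of its
      centre.\<close>
    have "eventually (\<lambda>r. r < d / CARD('n)) (at_right 0)"
      using \<open>d > 0\<close> by (intro order_tendstoD(2)[OF tendsto_ident_at]) simp
    moreover have "eventually (\<lambda>r :: real. 0 < r) (at_right 0)"
      by (simp add: eventually_at_right_less)
    ultimately show "eventually (\<lambda>r. dist (p r / (2 * r) ^ CARD('n)) (f x) < e) (at_right 0)"
    proof eventually_elim
      fix r assume r: "r < d / CARD('n)" "0 < r"
      define V where "V = (2 * r) ^ CARD('n)"
      have V: "V > 0" using r by (simp add: V_def)
      have eV: "emeasure lborel (B r) = ennreal V"
        using r by (simp add: B_def V_def emeasure_lborel_cube_cart)
      have near: "\<bar>f y - f x\<bar> < e'" if "y \<in> B r" for y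
      proof -
        have "norm (y - x) \<le> (\<Sum>i\<in>UNIV. \<bar>(y - x) $ i\<bar>)"
          by (rule norm_le_l1_cart)
        also have "\<dots> \<le> (\<Sum>i\<in>(UNIV :: 'n set). r)"
        proof (rule sum_mono)
          fix i show "\<bar>(y - x) $ i\<bar> \<le> r"
            using that by (auto simp: B_def mem_box_cart abs_le_iff algebra_simps dest!: spec[of _ i])
        qed
        also have "\<dots> < d" using r by (simp add: field_simps)
        finally show ?thesis using d[of y] by (simp add: dist_norm)
      qed
      have "ennreal (p r) \<le> (\<integral>\<^sup>+y. ennreal (f x + e') * indicator (B r) y \<partial>lborel)"
        unfolding p using near
        by (intro nn_integral_mono) (fastforce simp: indicator_def intro!: ennreal_leI)
      also have "\<dots> = ennreal ((f x + e') * V)"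
        using nonneg[of x] e' V by (simp add: nn_integral_cmult_indicator eV ennreal_mult)
      finally have upper: "p r \<le> (f x + e') * V"
        using nonneg[of x] e' V by (subst (asm) ennreal_le_iff) auto
      \<comment> \<open>The lower bound \<open>f x - e'\<close> may be negative; truncating at 0
        makes it compatible with \<open>ennreal\<close>, and it still lies below \<open>f\<close> on
        the cube.\<close>
      have "ennreal (max 0 (f x - e') * V) = (\<integral>\<^sup>+y. ennreal (max 0 (f x - e')) * indicator (B r) y \<partial>lborel)"
        using V by (simp add: nn_integral_cmult_indicator eV ennreal_mult)
      also have "\<dots> \<le> ennreal (p r)"
        unfolding p using near nonneg
        by (intro nn_integral_mono) (fastforce simp: indicator_def intro!: ennreal_leI)
      finally have "max 0 (f x - e') * V \<le> p r"
        by (subst (asm) ennreal_le_iff) (auto simp: p_def)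
      moreover have "(f x - e') * V \<le> max 0 (f x - e') * V"
        using V by (intro mult_right_mono) auto
      ultimately have lower: "(f x - e') * V \<le> p r" by linarith
      have "f x - e' \<le> p r / V" "p r / V \<le> f x + e'"
        using lower upper V by (auto simp: field_simps)
      then show "dist (p r / (2 * r) ^ CARD('n)) (f x) < e"
        using e' unfolding V_def[symmetric] dist_real_def by linarith
    qed
  qed
  then show ?thesis by (simp add: p_def B_def)
qed

section \<open>From independence to vanishing mixed derivatives of the logarithm\<close>

lemma four_point_identity:
  fixes X :: "'a \<Rightarrow> real ^ 'n"
  assumes "prob_space M"
    and X: "distributed M lborel X (\<lambda>x. ennreal (f x))"
    and cont: "continuous_on UNIV f" and nonneg: "\<And>x. 0 \<le> f x"
    and indep: "prob_space.indep_vars M (\<lambda>i. borel) (\<lambda>i \<omega>. X \<omega> $ i) UNIV"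
    and "i \<noteq> j"
  shows "f x * f (x + s *\<^sub>R axis i 1 + t *\<^sub>R axis j 1)
       = f (x + s *\<^sub>R axis i 1) * f (x + t *\<^sub>R axis j 1)"
proof -
  interpret prob_space M by fact
  define q where "q k c r = prob ((\<lambda>\<omega>. X \<omega> $ k) -` {c - r..c + r} \<inter> space M)" for k c r
  define Q where "Q y r = (\<Prod>k\<in>UNIV. q k (y $ k) r)" for y r
  have Q: "prob (X -` cbox (\<chi> k. y $ k - r) (\<chi> k. y $ k + r) \<inter> space M) = Q y r" for y r
  proof -
    have "X -` cbox (\<chi> k. y $ k - r) (\<chi> k. y $ k + r) \<inter> space M
        = (\<Inter>k\<in>UNIV. (\<lambda>\<omega>. X \<omega> $ k) -` {y $ k - r..y $ k + r} \<inter> space M)"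
      by (auto simp: mem_box_cart)
    then show ?thesis
      unfolding Q_def q_def using indep_varsD_finite[OF indep] by simp
  qed
  let ?V = "\<lambda>r :: real. (2 * r) ^ CARD('n)"
  have lim: "((\<lambda>r. Q y r / ?V r) \<longlongrightarrow> f y) (at_right 0)" for y
    using cube_average_tendsto_density[OF \<open>prob_space M\<close> X cont nonneg] by (simp add: Q)
  \<comment> \<open>In each coordinate both sides have the same two factors, swapped for coordinate
    \<open>i\<close>; this uses that \<open>i\<close> and \<open>j\<close> differ. Each side takes
    two factors \<open>?V r\<close>, so the identity survives averaging and passes to the
    limit.\<close>
  have "Q x r * Q (x + s *\<^sub>R axis i 1 + t *\<^sub>R axis j 1) r
      = Q (x + s *\<^sub>R axis i 1) r * Q (x + t *\<^sub>R axis j 1) r" for r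
    unfolding Q_def prod.distrib[symmetric]
    using \<open>i \<noteq> j\<close> by (intro prod.cong) (auto simp: axis_def)
  then have "(\<lambda>r. (Q x r / ?V r) * (Q (x + s *\<^sub>R axis i 1 + t *\<^sub>R axis j 1) r / ?V r))
      = (\<lambda>r. (Q (x + s *\<^sub>R axis i 1) r / ?V r) * (Q (x + t *\<^sub>R axis j 1) r / ?V r))"
    by simp
  then have "((\<lambda>r. (Q x r / ?V r) * (Q (x + s *\<^sub>R axis i 1 + t *\<^sub>R axis j 1) r / ?V r))
      \<longlongrightarrow> f (x + s *\<^sub>R axis i 1) * f (x + t *\<^sub>R axis j 1)) (at_right 0)"
    by (simp only: tendsto_mult[OF lim lim])
  then show ?thesis
    by (rule tendsto_unique[OF trivial_limit_at_right_real tendsto_mult[OF lim lim]])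
qed

text \<open>After taking logarithms, a shift by \<open>s\<close> along \<open>axis i 1\<close>
  changes the restriction of \<open>ln f\<close> to a line in direction \<open>axis j 1\<close> only
  by a constant. Hence the \<open>j\<close>-th partial derivative is constant in direction
  \<open>i\<close>.\<close>

lemma diff_cumulant_eq_0_if_four_point_identity:
  fixes f :: "real ^ 'n \<Rightarrow> real"
  assumes pos: "\<And>x. 0 < f x"
    and smooth: "times_cont_diff (Suc (Suc k)) f"
    and four: "\<And>x s t. f x * f (x + s *\<^sub>R axis i 1 + t *\<^sub>R axis j 1)
       = f (x + s *\<^sub>R axis i 1) * f (x + t *\<^sub>R axis j 1)"
  shows "diff_cumulant f i j x = 0"
proof -
  let ?L = "\<lambda>x. ln (f x)"
  note diff = ln_partial_derivs_differentiable(1)[OF pos smooth]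
  have "partial_deriv j ?L (x + s *\<^sub>R axis i 1) = partial_deriv j ?L x" for s
  proof -
    have "?L (x + s *\<^sub>R axis i 1 + t *\<^sub>R axis j 1)
        = ?L (x + t *\<^sub>R axis j 1) + (?L (x + s *\<^sub>R axis i 1) - ?L x)" for t
      using arg_cong[OF four[of x s t], of ln] by (simp add: ln_mult less_imp_neq[OF pos, symmetric])
    moreover have "((\<lambda>t. ?L (x + t *\<^sub>R axis j 1)) has_real_derivative partial_deriv j ?L x) (at 0)"
      using has_real_derivative_along_line[where g = ?L and x = x and t = 0 and v = "axis j 1"] diff
      by (simp add: partial_deriv_eq_frechet_derivative)
    then have "((\<lambda>t. ?L (x + t *\<^sub>R axis j 1) + (?L (x + s *\<^sub>R axis i 1) - ?L x))
        has_real_derivative partial_deriv j ?L x) (at 0)"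
      using DERIV_add[OF _ DERIV_const] by fastforce
    ultimately show ?thesis
      by (simp add: partial_deriv_def[of j ?L "x + s *\<^sub>R axis i 1"] DERIV_imp_deriv)
  qed
  then show ?thesis
    unfolding diff_cumulant_def by (subst partial_deriv_def) simp
qed

theorem theorem4:
  fixes M :: "'a measure"
    and X :: "'a \<Rightarrow> real ^ 'n"
    and f :: "real ^ 'n \<Rightarrow> real"
  assumes "prob_space M"
    and "distributed M lborel X (\<lambda>x. ennreal (f x))"
    and "\<And>x. 0 < f x"
    and "times_cont_diff (CARD('n) + 1) f"
  shows "prob_space.indep_vars M (\<lambda>i. borel) (\<lambda>i \<omega>. X \<omega> $ i) (UNIV :: 'n set) \<longleftrightarrow>
         (\<forall>x. \<forall>i j. i \<noteq> j \<longrightarrow> diff_cumulant f i j x = 0)"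
proof -
  \<comment> \<open>The dimension is at least 1, so order \<open>CARD('n) + 1\<close> includes the
    two orders of smoothness that the cumulants require.\<close>
  obtain k where "CARD('n) = Suc k"
    using zero_less_card_finite[where 'a = 'n] gr0_implies_Suc by blast
  then have smooth: "times_cont_diff (Suc (Suc k)) f"
    using assms(4) by simp
  then have cont: "continuous_on UNIV f"
    by (auto intro!: differentiable_imp_continuous_on simp: differentiable_on_def)
  show ?thesis
  proof (intro iffI allI impI)
    fix x :: "real ^ 'n" and i j :: 'n
    assume "prob_space.indep_vars M (\<lambda>i. borel) (\<lambda>i \<omega>. X \<omega> $ i) (UNIV :: 'n set)" "i \<noteq> j"
    then show "diff_cumulant f i j x = 0"
      using four_point_identity[OF assms(1,2) cont less_imp_le[OF assms(3)]]
      by (intro diff_cumulant_eq_0_if_four_point_identity[OF assms(3) smooth])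
  next
    assume "\<forall>x. \<forall>i j. i \<noteq> j \<longrightarrow> diff_cumulant f i j x = 0"
    then have product: "f x = f 0 * (\<Prod>i\<in>UNIV. f (axis i (x $ i)) / f 0)" for x
      using assms(3) smooth by (intro product_form_if_diff_cumulants_zero) auto
    have measurable: "(\<lambda>t. f (axis i t) / f 0) \<in> borel_measurable borel" for i
    proof -
      \<comment> \<open>Writing \<open>axis i t\<close> as a scalar multiple of a fixed vector makes
        continuity in \<open>t\<close> evident.\<close>
      have "continuous_on UNIV (\<lambda>t. f (t *\<^sub>R axis i 1) / f 0)"
        using less_imp_neq[OF assms(3)]
        by (intro continuous_intros continuous_on_compose2[OF cont]) auto
      moreover have "t *\<^sub>R axis i 1 = (axis i t :: real ^ 'n)" for t :: real
        by (simp add: axis_def vec_eq_iff)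
      ultimately show ?thesis by (simp add: borel_measurable_continuous_onI)
    qed
    show "prob_space.indep_vars M (\<lambda>i. borel) (\<lambda>i \<omega>. X \<omega> $ i) (UNIV :: 'n set)"
      by (rule indep_vars_if_product_form[where h = "\<lambda>i t. f (axis i t) / f 0",
            OF assms(1,2) product _ _ measurable])
        (simp_all add: less_imp_le[OF assms(3)])
  qed
qed

end
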